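(* Let $S$ be a Boolean inverse semigroup. (1) If $S$ is semisimple, then the groupoid $\mathsf{G}(S)$ of prime filters of $S$ is isomorphic to the groupoid of atoms of $S$ under the restricted product. (2) $S$ is semisimple if and only if the topology on $\mathsf{G}(S)$ is discrete.
   Context: For an inverse semigroup $S$, $\mathsf{E}(S)$ is its set of idempotents, $\mathbf{d}(a)=a^{-1}a$ and $\mathbf{r}(a)=aa^{-1}$. The natural partial order is $a\le b$ iff $a=ba^{-1}a$; joins and meets refer to it; $a^{\downarrow}=\{x: x\le a\}$ and, for $A\subseteq S$, $A^{\uparrow}=\{x: a\le x\text{ for some }a\in A\}$. Elements $a,b$ are compatible, $a\sim b$, if $a^{-1}b$ and $ab^{-1}$ are both idempotents. A Boolean algebra here means a generalized Boolean algebra: a distributive lattice with bottom (a top is not required) in which every principal order-ideal is a (unital) Boolean algebra. An inverse semigroup with zero is distributive if any two compatible elements have a join and multiplication distributes on both sides over such joins; it is Boolean if in addition $(\mathsf{E}(S),\le)$ is a Boolean algebra. Boolean inverse semigroups are assumed not to be the zero semigroup $\{0\}$. $S$ is semisimple if $a^{\downarrow}$ is finite for each $a\in S$. An atom is a non-zero $a$ such that $x\le a$ implies $x=a$ or $x=0$. The restricted product $a\cdot b$ is defined exactly when $\mathbf{d}(a)=\mathbf{r}(b)$, and then equals $ab$; the atoms form a groupoid under it. A filter in $S$ is a non-empty subset $F$ with $F^{\uparrow}=F$ such that $a,b\in F$ implies there is $c\in F$ with $c\le a,b$. It is proper if $0\notin F$. A proper filter $F$ is prime if whenever $a\sim b$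 and $a\vee b\in F$, then $a\in F$ or $b\in F$. For a filter $F$ put $\mathbf{d}(F)=(F^{-1}F)^{\uparrow}$ and $\mathbf{r}(F)=(FF^{-1})^{\uparrow}$. The set $\mathsf{G}(S)$ of prime filters is a groupoid: $A\cdot B$ is defined iff $\mathbf{d}(A)=\mathbf{r}(B)$, and then $A\cdot B=(AB)^{\uparrow}$. Its topology has as basis the sets $V_{a}=\{F\in\mathsf{G}(S): a\in F\}$, $a\in S$. *)

theory Defs
  imports "HOL-Algebra.Lattice" "HOL-Analysis.Abstract_Topology"
begin

section \<open>Generalized Boolean algebras\<close>

locale distributive_lattice = Lattice.lattice L for L (structure) +
  assumes meet_join_distrib:
    "\<lbrakk>x \<in> carrier L; y \<in> carrier L; z \<in> carrier L\<rbrakk>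
      \<Longrightarrow> x \<sqinter> (y \<squnion> z) = (x \<sqinter> y) \<squnion> (x \<sqinter> z)"

locale unital_boolean_lattice =
  distributive_lattice L + Lattice.bounded_lattice L for L (structure) +
  assumes complement_exists:
    "x \<in> carrier L \<Longrightarrow> \<exists>y \<in> carrier L. x \<sqinter> y = \<bottom> \<and> x \<squnion> y = \<top>"

locale generalized_boolean_lattice =
  distributive_lattice L + weak_partial_order_bottom L for L (structure) +
  assumes principal_ideal_boolean:
    "e \<in> carrier L \<Longrightarrow> unital_boolean_lattice (L\<lparr>carrier := {x \<in> carrier L. x \<sqsubseteq> e}\<rparr>)"

section \<open>Inverse semigroups with zero\<close>

record 'a zero_semigroup = "'a partial_object" +
  smult :: "'a \<Rightarrow> 'a \<Rightarrow> 'a" (infixl \<open>\<odot>\<index>\<close> 70)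
  szero :: 'a (\<open>\<zero>\<index>\<close>)

locale inverse_semigroup_zero =
  fixes S :: "'a zero_semigroup" (structure)
  assumes mult_closed: "\<lbrakk>a \<in> carrier S; b \<in> carrier S\<rbrakk> \<Longrightarrow> a \<odot> b \<in> carrier S"
    and mult_assoc: "\<lbrakk>a \<in> carrier S; b \<in> carrier S; c \<in> carrier S\<rbrakk>
          \<Longrightarrow> (a \<odot> b) \<odot> c = a \<odot> (b \<odot> c)"
    and inverse_ex1: "a \<in> carrier S
          \<Longrightarrow> \<exists>!b. b \<in> carrier S \<and> a \<odot> b \<odot> a = a \<and> b \<odot> a \<odot> b = b"
    and zero_closed: "\<zero> \<in> carrier S"
    and zero_mult: "a \<in> carrier S \<Longrightarrow> \<zero> \<odot> a = \<zero>"
    and mult_zero: "a \<in> carrier S \<Longrightarrow> a \<odot> \<zero> = \<zero>"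

definition sinv :: "'a zero_semigroup \<Rightarrow> 'a \<Rightarrow> 'a" where
  "sinv S a = (THE b. b \<in> carrier S \<and> a \<odot>\<^bsub>S\<^esub> b \<odot>\<^bsub>S\<^esub> a = a \<and> b \<odot>\<^bsub>S\<^esub> a \<odot>\<^bsub>S\<^esub> b = b)"

definition idempotents :: "'a zero_semigroup \<Rightarrow> 'a set" where
  "idempotents S = {e \<in> carrier S. e \<odot>\<^bsub>S\<^esub> e = e}"

definition sdom :: "'a zero_semigroup \<Rightarrow> 'a \<Rightarrow> 'a" where
  "sdom S a = sinv S a \<odot>\<^bsub>S\<^esub> a"

definition sran :: "'a zero_semigroup \<Rightarrow> 'a \<Rightarrow> 'a" where
  "sran S a = a \<odot>\<^bsub>S\<^esub> sinv S a"

text \<open>The natural partial order, packaged as an ordered set so that the joins and meets of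
  HOL-Algebra refer to it.\<close>

definition nat_order :: "'a zero_semigroup \<Rightarrow> 'a gorder" where
  "nat_order S = \<lparr>carrier = carrier S, eq = (=),
     le = (\<lambda>a b. a = b \<odot>\<^bsub>S\<^esub> sinv S a \<odot>\<^bsub>S\<^esub> a)\<rparr>"

definition idempotent_order :: "'a zero_semigroup \<Rightarrow> 'a gorder" where
  "idempotent_order S = (nat_order S)\<lparr>carrier := idempotents S\<rparr>"

definition down_set :: "'a zero_semigroup \<Rightarrow> 'a \<Rightarrow> 'a set" where
  "down_set S a = {x \<in> carrier S. x \<sqsubseteq>\<^bsub>nat_order S\<^esub> a}"

definition up_set :: "'a zero_semigroup \<Rightarrow> 'a set \<Rightarrow> 'a set" where
  "up_set S A = {x \<in> carrier S. \<exists>a \<in> A. a \<sqsubseteq>\<^bsub>nat_order S\<^esub> x}"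

definition compatible :: "'a zero_semigroup \<Rightarrow> 'a \<Rightarrow> 'a \<Rightarrow> bool" where
  "compatible S a b \<longleftrightarrow>
     sinv S a \<odot>\<^bsub>S\<^esub> b \<in> idempotents S \<and> a \<odot>\<^bsub>S\<^esub> sinv S b \<in> idempotents S"

text \<open>In the two distributivity axioms the joins on the right exist, because left and right
  multiples of compatible elements are again compatible.\<close>

locale distributive_inverse_semigroup = inverse_semigroup_zero +
  assumes compatible_join_exists:
    "\<lbrakk>a \<in> carrier S; b \<in> carrier S; compatible S a b\<rbrakk>
      \<Longrightarrow> \<exists>j. least (nat_order S) j (Upper (nat_order S) {a, b})"
    and mult_join_left:
    "\<lbrakk>a \<in> carrier S; b \<in> carrier S; c \<in> carrier S; compatible S a b\<rbrakk>
      \<Longrightarrow> c \<odot> (a \<squnion>\<^bsub>nat_order S\<^esub> b) = (c \<odot> a) \<squnion>\<^bsub>nat_order S\<^esub> (c \<odot> b)"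
    and mult_join_right:
    "\<lbrakk>a \<in> carrier S; b \<in> carrier S; c \<in> carrier S; compatible S a b\<rbrakk>
      \<Longrightarrow> (a \<squnion>\<^bsub>nat_order S\<^esub> b) \<odot> c = (a \<odot> c) \<squnion>\<^bsub>nat_order S\<^esub> (b \<odot> c)"

locale boolean_inverse_semigroup = distributive_inverse_semigroup +
  assumes idempotents_boolean: "generalized_boolean_lattice (idempotent_order S)"
    and not_zero_semigroup: "carrier S \<noteq> {\<zero>}"

definition semisimple :: "'a zero_semigroup \<Rightarrow> bool" where
  "semisimple S \<longleftrightarrow> (\<forall>a \<in> carrier S. finite (down_set S a))"

section \<open>Groupoids\<close>

text \<open>\<open>gcomp G x y\<close> is the partial product, meaningful only when \<open>gdom G x = gran G y\<close>;
  its values on other pairs are irrelevant. Identities are identified with the elements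
  \<open>gdom G x\<close> of the carrier.\<close>

record 'g pre_groupoid = "'g partial_object" +
  gdom :: "'g \<Rightarrow> 'g"
  gran :: "'g \<Rightarrow> 'g"
  gcomp :: "'g \<Rightarrow> 'g \<Rightarrow> 'g"

locale groupoid =
  fixes G :: "'g pre_groupoid"
  assumes dom_closed: "x \<in> carrier G \<Longrightarrow> gdom G x \<in> carrier G"
    and ran_closed: "x \<in> carrier G \<Longrightarrow> gran G x \<in> carrier G"
    and dom_dom: "x \<in> carrier G \<Longrightarrow> gdom G (gdom G x) = gdom G x"
    and ran_dom: "x \<in> carrier G \<Longrightarrow> gran G (gdom G x) = gdom G x"
    and dom_ran: "x \<in> carrier G \<Longrightarrow> gdom G (gran G x) = gran G x"
    and ran_ran: "x \<in> carrier G \<Longrightarrow> gran G (gran G x) = gran G x"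
    and comp_closed: "\<lbrakk>x \<in> carrier G; y \<in> carrier G; gdom G x = gran G y\<rbrakk>
          \<Longrightarrow> gcomp G x y \<in> carrier G"
    and dom_comp: "\<lbrakk>x \<in> carrier G; y \<in> carrier G; gdom G x = gran G y\<rbrakk>
          \<Longrightarrow> gdom G (gcomp G x y) = gdom G y"
    and ran_comp: "\<lbrakk>x \<in> carrier G; y \<in> carrier G; gdom G x = gran G y\<rbrakk>
          \<Longrightarrow> gran G (gcomp G x y) = gran G x"
    and comp_assoc: "\<lbrakk>x \<in> carrier G; y \<in> carrier G; z \<in> carrier G;
            gdom G x = gran G y; gdom G y = gran G z\<rbrakk>
          \<Longrightarrow> gcomp G (gcomp G x y) z = gcomp G x (gcomp G y z)"
    and comp_dom: "x \<in> carrier G \<Longrightarrow> gcomp G x (gdom G x) = x"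
    and ran_comp_self: "x \<in> carrier G \<Longrightarrow> gcomp G (gran G x) x = x"
    and inverse_exists: "x \<in> carrier G \<Longrightarrow>
          \<exists>y \<in> carrier G. gdom G y = gran G x \<and> gran G y = gdom G x \<and>
            gcomp G x y = gran G x \<and> gcomp G y x = gdom G x"

definition groupoid_functor :: "'g pre_groupoid \<Rightarrow> 'h pre_groupoid \<Rightarrow> ('g \<Rightarrow> 'h) \<Rightarrow> bool" where
  "groupoid_functor G H f \<longleftrightarrow>
     f \<in> carrier G \<rightarrow> carrier H \<and>
     (\<forall>x \<in> carrier G. f (gdom G x) = gdom H (f x) \<and> f (gran G x) = gran H (f x)) \<and>
     (\<forall>x \<in> carrier G. \<forall>y \<in> carrier G. gdom G x = gran G y \<longrightarrow>
        f (gcomp G x y) = gcomp H (f x) (f y))"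

definition isomorphic_groupoids :: "'g pre_groupoid \<Rightarrow> 'h pre_groupoid \<Rightarrow> bool" where
  "isomorphic_groupoids G H \<longleftrightarrow> groupoid G \<and> groupoid H \<and>
     (\<exists>f. groupoid_functor G H f \<and> bij_betw f (carrier G) (carrier H))"

section \<open>The groupoid of atoms and the groupoid of prime filters\<close>

definition atoms :: "'a zero_semigroup \<Rightarrow> 'a set" where
  "atoms S = {a \<in> carrier S. a \<noteq> \<zero>\<^bsub>S\<^esub> \<and>
     (\<forall>x \<in> carrier S. x \<sqsubseteq>\<^bsub>nat_order S\<^esub> a \<longrightarrow> x = a \<or> x = \<zero>\<^bsub>S\<^esub>)}"

definition atom_groupoid :: "'a zero_semigroup \<Rightarrow> 'a pre_groupoid" where
  "atom_groupoid S =
     \<lparr>carrier = atoms S, gdom = sdom S, gran = sran S, gcomp = smult S\<rparr>"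

definition is_filter :: "'a zero_semigroup \<Rightarrow> 'a set \<Rightarrow> bool" where
  "is_filter S F \<longleftrightarrow> F \<subseteq> carrier S \<and> F \<noteq> {} \<and> up_set S F = F \<and>
     (\<forall>a \<in> F. \<forall>b \<in> F. \<exists>c \<in> F. c \<sqsubseteq>\<^bsub>nat_order S\<^esub> a \<and> c \<sqsubseteq>\<^bsub>nat_order S\<^esub> b)"

definition prime_filters :: "'a zero_semigroup \<Rightarrow> 'a set set" where
  "prime_filters S = {F. is_filter S F \<and> \<zero>\<^bsub>S\<^esub> \<notin> F \<and>
     (\<forall>a \<in> carrier S. \<forall>b \<in> carrier S.
        compatible S a b \<and> a \<squnion>\<^bsub>nat_order S\<^esub> b \<in> F \<longrightarrow> a \<in> F \<or> b \<in> F)}"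

definition set_mult :: "'a zero_semigroup \<Rightarrow> 'a set \<Rightarrow> 'a set \<Rightarrow> 'a set" where
  "set_mult S A B = {a \<odot>\<^bsub>S\<^esub> b | a b. a \<in> A \<and> b \<in> B}"

definition prime_filter_groupoid :: "'a zero_semigroup \<Rightarrow> 'a set pre_groupoid" where
  "prime_filter_groupoid S =
     \<lparr>carrier = prime_filters S,
      gdom = (\<lambda>F. up_set S (set_mult S (sinv S ` F) F)),
      gran = (\<lambda>F. up_set S (set_mult S F (sinv S ` F))),
      gcomp = (\<lambda>A B. up_set S (set_mult S A B))\<rparr>"

definition basic_open :: "'a zero_semigroup \<Rightarrow> 'a \<Rightarrow> 'a set set" where
  "basic_open S a = {F \<in> prime_filters S. a \<in> F}"

definition prime_filter_topology :: "'a zero_semigroup \<Rightarrow> 'a set topology" where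
  "prime_filter_topology S =
     topology (arbitrary union_of (\<lambda>U. \<exists>a \<in> carrier S. U = basic_open S a))"

text \<open>The sets \<open>basic_open S a\<close> do form a basis, so \<open>topology\<close> is applied to a genuine family
  of open sets.\<close>

lemma openin_prime_filter_topology:
  "openin (prime_filter_topology S) =
     arbitrary union_of (\<lambda>U. \<exists>a \<in> carrier S. U = basic_open S a)"
proof -
  let ?P = "\<lambda>U. \<exists>a \<in> carrier S. U = basic_open S a"
  have "(arbitrary union_of ?P) (basic_open S a \<inter> basic_open S b)"
    if ab: "a \<in> carrier S" "b \<in> carrier S" for a b
  proof -
    let ?C = "{c \<in> carrier S. c \<sqsubseteq>\<^bsub>nat_order S\<^esub> a \<and> c \<sqsubseteq>\<^bsub>nat_order S\<^esub> b}"
    have "basic_open S a \<inter> basic_open S b = \<Union> (basic_open S ` ?C)"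
    proof (intro subset_antisym subsetI)
      fix F assume F: "F \<in> basic_open S a \<inter> basic_open S b"
      then have "is_filter S F" "a \<in> F" "b \<in> F" "F \<in> prime_filters S"
        by (auto simp: basic_open_def prime_filters_def)
      then obtain c where "c \<in> F" "c \<in> ?C"
        unfolding is_filter_def by blast
      then show "F \<in> \<Union> (basic_open S ` ?C)"
        using \<open>F \<in> prime_filters S\<close> by (auto simp: basic_open_def)
    next
      fix F assume "F \<in> \<Union> (basic_open S ` ?C)"
      then obtain c where c: "c \<in> ?C" "c \<in> F" "F \<in> prime_filters S"
        by (auto simp: basic_open_def)
      then have "up_set S F = F"
        by (simp add: prime_filters_def is_filter_def)
      then have "a \<in> F" "b \<in> F"
        using c ab unfolding up_set_def by blast+
      then show "F \<in> basic_open S a \<inter> basic_open S b"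
        using c by (simp add: basic_open_def)
    qed
    moreover have "(arbitrary union_of ?P) (\<Union> (basic_open S ` ?C))"
    proof (rule arbitrary_union_of_Union)
      fix U assume "U \<in> basic_open S ` ?C"
      then have "?P U" by blast
      then show "(arbitrary union_of ?P) U" by (rule arbitrary_union_of_inc)
    qed
    ultimately show ?thesis by simp
  qed
  then have "istopology (arbitrary union_of ?P)"
    unfolding istopology_base_eq by blast
  then show ?thesis
    by (simp add: prime_filter_topology_def topology_inverse')
qed

lemma topspace_prime_filter_topology: "topspace (prime_filter_topology S) = prime_filters S"
proof (intro subset_antisym subsetI)
  fix F assume "F \<in> topspace (prime_filter_topology S)"
  then obtain U where "(arbitrary union_of (\<lambda>U. \<exists>a \<in> carrier S. U = basic_open S a)) U" "F \<in> U"
    unfolding topspace_def openin_prime_filter_topology by blast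
  then obtain V where "F \<in> V" "\<exists>a \<in> carrier S. V = basic_open S a"
    unfolding union_of_def by blast
  then show "F \<in> prime_filters S"
    unfolding basic_open_def by blast
next
  fix F assume F: "F \<in> prime_filters S"
  then obtain a where a: "a \<in> carrier S" "a \<in> F"
    unfolding prime_filters_def is_filter_def by blast
  have "openin (prime_filter_topology S) (basic_open S a)"
    unfolding openin_prime_filter_topology by (rule arbitrary_union_of_inc) (use a in blast)
  then have "basic_open S a \<subseteq> topspace (prime_filter_topology S)"
    by (rule openin_subset)
  moreover have "F \<in> basic_open S a"
    using F a by (simp add: basic_open_def)
  ultimately show "F \<in> topspace (prime_filter_topology S)"
    by blast
qed

end

theory Submission
  imports Defs
begin

text \<open>
  The up-set of an atom is always a prime filter, and in a semisimple Boolean inverse semigroup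
  there are no others. Indeed, a filter having a member with finite down-set has a least element
  \<open>b\<close> (\<open>filter_principal\<close>), and if some \<open>c\<close> were strictly between \<open>\<zero>\<close> and \<open>b\<close>, then a relative
  complement would write \<open>b\<close> as the join of \<open>c\<close> and another element strictly below \<open>b\<close>; neither
  of the two lies in the filter, against primeness (\<open>prime_principal_atom\<close>). So atoms correspond
  to prime filters, and the correspondence respects the groupoid operations because multiplication
  and inversion are monotone: the product of the up-sets of \<open>a\<close> and \<open>b\<close> generates the up-set of
  \<open>a \<odot> b\<close>. That prime filters form a groupoid is, in this situation, inherited from the
  atoms. Moreover the up-set of an atom \<open>b\<close> is the only prime filter containing \<open>b\<close>, so the
  topology is discrete.

  For the converse, the idempotents with finite down-set form an ideal of the lattice of
  idempotents, since every element below the join of \<open>e\<close> and \<open>f\<close> is the join of an element below \<open>e\<close> and an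
  element below \<open>f\<close>. If the ideal is proper, Zorn's lemma yields a prime filter \<open>F\<close> that contains
  an idempotent and misses the ideal (\<open>prime_filter_separation\<close>). When the topology is discrete,
  \<open>F\<close> is the only prime filter containing some idempotent \<open>f\<close>. By separation again such an \<open>f\<close>
  is an atom, so its down-set is finite and \<open>f\<close> belongs to the ideal, a contradiction. Hence all
  idempotents have finite down-sets; and as an element below \<open>a\<close> is determined by its domain, which
  lies below the domain of \<open>a\<close>, so do all elements.
\<close>

section \<open>Inverse semigroups and the natural partial order\<close>

context inverse_semigroup_zero
begin

abbreviation inverse_of (\<open>(_\<^sup>\<star>)\<close> [1000] 1000) where "a\<^sup>\<star> \<equiv> sinv S a"
abbreviation idems (\<open>E\<close>) where "E \<equiv> idempotents S"
abbreviation natural_le (infix \<open>\<preceq>\<close> 50) where "a \<preceq> b \<equiv> a \<sqsubseteq>\<^bsub>nat_order S\<^esub> b"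
abbreviation natural_join (infixl \<open>\<uplus>\<close> 65) where "a \<uplus> b \<equiv> a \<squnion>\<^bsub>nat_order S\<^esub> b"

declare mult_closed [simp] zero_closed [simp] zero_mult [simp] mult_zero [simp]

lemma sinv_props:
  assumes "a \<in> carrier S"
  shows sinv_closed [simp]: "a\<^sup>\<star> \<in> carrier S"
    and mult_sinv_mult: "a \<odot> a\<^sup>\<star> \<odot> a = a"
    and sinv_mult_sinv: "a\<^sup>\<star> \<odot> a \<odot> a\<^sup>\<star> = a\<^sup>\<star>"
  using theI' [OF inverse_ex1 [OF assms]] unfolding sinv_def by auto

lemma sinv_eqI:
  assumes "a \<in> carrier S" "b \<in> carrier S" "a \<odot> b \<odot> a = a" "b \<odot> a \<odot> b = b"
  shows "a\<^sup>\<star> = b"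
  using inverse_ex1 [OF assms(1)] assms sinv_props [OF assms(1)] by blast

lemma sinv_sinv [simp]: "a \<in> carrier S \<Longrightarrow> (a\<^sup>\<star>)\<^sup>\<star> = a"
  by (rule sinv_eqI) (simp_all add: mult_sinv_mult sinv_mult_sinv)

lemma idem_idem: "e \<in> E \<Longrightarrow> e \<odot> e = e"
  by (simp add: idempotents_def)

lemma idemI: "e \<in> carrier S \<Longrightarrow> e \<odot> e = e \<Longrightarrow> e \<in> E"
  by (simp add: idempotents_def)

lemma idem_closed [simp]: "e \<in> E \<Longrightarrow> e \<in> carrier S"
  by (simp add: idempotents_def)

lemma zero_idem [simp]: "\<zero> \<in> E"
  by (simp add: idemI)

lemma sinv_idem [simp]: "e \<in> E \<Longrightarrow> e\<^sup>\<star> = e"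
  by (rule sinv_eqI) (simp_all add: idem_idem)

text \<open>With \<open>x\<close> the inverse of \<open>e \<odot> f\<close>, the element \<open>f \<odot> x \<odot> e\<close> is an idempotent that is again an
  inverse of \<open>e \<odot> f\<close>; hence \<open>x\<close> is idempotent and therefore its own inverse, that is,
  \<open>x = e \<odot> f\<close>.\<close>

lemma idem_mult [simp]:
  assumes e: "e \<in> E" and f: "f \<in> E"
  shows "e \<odot> f \<in> E"
proof -
  define x where "x = (e \<odot> f)\<^sup>\<star>"
  have c [simp]: "e \<in> carrier S" "f \<in> carrier S" "x \<in> carrier S"
    using e f by (simp_all add: x_def)
  have ee: "e \<odot> (e \<odot> y) = e \<odot> y" if "y \<in> carrier S" for y
    using that mult_assoc [of e e y] idem_idem [OF e] by simp
  have ff: "f \<odot> (f \<odot> y) = f \<odot> y" if "y \<in> carrier S" for y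
    using that mult_assoc [of f f y] idem_idem [OF f] by simp
  have 1: "e \<odot> (f \<odot> (x \<odot> (e \<odot> f))) = e \<odot> f"
    using mult_sinv_mult [of "e \<odot> f"] by (simp add: x_def [symmetric] mult_assoc)
  have 2: "x \<odot> (e \<odot> (f \<odot> x)) = x"
    using sinv_mult_sinv [of "e \<odot> f"] by (simp add: x_def [symmetric] mult_assoc)
  have 3: "x \<odot> (e \<odot> (f \<odot> (x \<odot> e))) = x \<odot> e"
    using arg_cong [OF 2, of "\<lambda>y. y \<odot> e"] by (simp add: mult_assoc)
  have x: "x = f \<odot> x \<odot> e"
    unfolding x_def
    by (rule sinv_eqI) (simp_all add: x_def [symmetric] mult_assoc ee ff 1 3)
  have "x \<odot> x = (f \<odot> x \<odot> e) \<odot> (f \<odot> x \<odot> e)"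
    by (rule arg_cong2 [OF x x])
  also have "\<dots> = f \<odot> x \<odot> e"
    by (simp add: mult_assoc 3)
  also have "\<dots> = x"
    by (rule x [symmetric])
  finally have "x \<odot> x = x" .
  then have "x \<in> E" by (simp add: idemI)
  moreover have "x\<^sup>\<star> = e \<odot> f" by (simp add: x_def)
  ultimately show ?thesis by simp
qed

lemma idem_commute:
  assumes e: "e \<in> E" and f: "f \<in> E"
  shows "e \<odot> f = f \<odot> e"
proof -
  have c [simp]: "e \<in> carrier S" "f \<in> carrier S"
    using e f by simp_all
  have ee: "e \<odot> (e \<odot> y) = e \<odot> y" if "y \<in> carrier S" for y
    using that mult_assoc [of e e y] idem_idem [OF e] by simp
  have ff: "f \<odot> (f \<odot> y) = f \<odot> y" if "y \<in> carrier S" for y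
    using that mult_assoc [of f f y] idem_idem [OF f] by simp
  have "(e \<odot> f)\<^sup>\<star> = f \<odot> e"
    using idem_idem [OF idem_mult [OF e f]] idem_idem [OF idem_mult [OF f e]]
    by (intro sinv_eqI) (simp_all add: mult_assoc ee ff)
  then show ?thesis
    unfolding sinv_idem [OF idem_mult [OF e f]] .
qed

lemma sdom_idem [simp]:
  assumes [simp]: "a \<in> carrier S"
  shows "a\<^sup>\<star> \<odot> a \<in> E"
proof (rule idemI)
  have "a\<^sup>\<star> \<odot> a \<odot> (a\<^sup>\<star> \<odot> a) = (a\<^sup>\<star> \<odot> a \<odot> a\<^sup>\<star>) \<odot> a"
    by (simp add: mult_assoc)
  then show "a\<^sup>\<star> \<odot> a \<odot> (a\<^sup>\<star> \<odot> a) = a\<^sup>\<star> \<odot> a"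
    unfolding sinv_mult_sinv [OF assms] .
qed simp

lemma sran_idem [simp]: "a \<in> carrier S \<Longrightarrow> a \<odot> a\<^sup>\<star> \<in> E"
  using sdom_idem [of "a\<^sup>\<star>"] by simp

lemma sinv_mult:
  assumes [simp]: "a \<in> carrier S" "b \<in> carrier S"
  shows "(a \<odot> b)\<^sup>\<star> = b\<^sup>\<star> \<odot> a\<^sup>\<star>"
proof (rule sinv_eqI)
  have comm: "(b \<odot> b\<^sup>\<star>) \<odot> (a\<^sup>\<star> \<odot> a) = (a\<^sup>\<star> \<odot> a) \<odot> (b \<odot> b\<^sup>\<star>)"
    by (rule idem_commute) simp_all
  have "a \<odot> b \<odot> (b\<^sup>\<star> \<odot> a\<^sup>\<star>) \<odot> (a \<odot> b) = a \<odot> ((b \<odot> b\<^sup>\<star>) \<odot> (a\<^sup>\<star> \<odot> a)) \<odot> b"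
    by (simp add: mult_assoc)
  also have "\<dots> = (a \<odot> a\<^sup>\<star> \<odot> a) \<odot> (b \<odot> b\<^sup>\<star> \<odot> b)"
    unfolding comm by (simp add: mult_assoc)
  finally show "a \<odot> b \<odot> (b\<^sup>\<star> \<odot> a\<^sup>\<star>) \<odot> (a \<odot> b) = a \<odot> b"
    by (simp add: mult_sinv_mult)
  have "b\<^sup>\<star> \<odot> a\<^sup>\<star> \<odot> (a \<odot> b) \<odot> (b\<^sup>\<star> \<odot> a\<^sup>\<star>) = b\<^sup>\<star> \<odot> ((a\<^sup>\<star> \<odot> a) \<odot> (b \<odot> b\<^sup>\<star>)) \<odot> a\<^sup>\<star>"
    by (simp add: mult_assoc)
  also have "\<dots> = (b\<^sup>\<star> \<odot> b \<odot> b\<^sup>\<star>) \<odot> (a\<^sup>\<star> \<odot> a \<odot> a\<^sup>\<star>)"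
    unfolding comm [symmetric] by (simp add: mult_assoc)
  finally show "b\<^sup>\<star> \<odot> a\<^sup>\<star> \<odot> (a \<odot> b) \<odot> (b\<^sup>\<star> \<odot> a\<^sup>\<star>) = b\<^sup>\<star> \<odot> a\<^sup>\<star>"
    by (simp add: sinv_mult_sinv)
qed simp_all

lemma le_iff: "a \<preceq> b \<longleftrightarrow> a = b \<odot> a\<^sup>\<star> \<odot> a"
  by (simp add: nat_order_def)

lemma conjugate_idem [simp]:
  assumes [simp]: "a \<in> carrier S" "e \<in> E"
  shows "a \<odot> e \<odot> a\<^sup>\<star> \<in> E"
proof (rule idemI)
  have "a \<odot> e \<odot> a\<^sup>\<star> \<odot> (a \<odot> e \<odot> a\<^sup>\<star>) = a \<odot> (e \<odot> (a\<^sup>\<star> \<odot> a)) \<odot> e \<odot> a\<^sup>\<star>"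
    by (simp add: mult_assoc)
  also have "\<dots> = (a \<odot> a\<^sup>\<star> \<odot> a) \<odot> (e \<odot> e) \<odot> a\<^sup>\<star>"
    unfolding idem_commute [OF \<open>e \<in> E\<close> sdom_idem [OF assms(1)]] by (simp add: mult_assoc)
  finally show "a \<odot> e \<odot> a\<^sup>\<star> \<odot> (a \<odot> e \<odot> a\<^sup>\<star>) = a \<odot> e \<odot> a\<^sup>\<star>"
    by (simp add: mult_sinv_mult idem_idem)
qed simp

text \<open>An idempotent moves across an element at the price of a conjugation; this is why the natural
  partial order is left-right symmetric.\<close>

lemma mult_idem_swap:
  assumes [simp]: "a \<in> carrier S" "e \<in> E"
  shows "a \<odot> e = (a \<odot> e \<odot> a\<^sup>\<star>) \<odot> a"
proof -
  have "(a \<odot> e \<odot> a\<^sup>\<star>) \<odot> a = a \<odot> (e \<odot> (a\<^sup>\<star> \<odot> a))"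
    by (simp add: mult_assoc)
  also have "\<dots> = (a \<odot> a\<^sup>\<star> \<odot> a) \<odot> e"
    unfolding idem_commute [OF \<open>e \<in> E\<close> sdom_idem [OF assms(1)]] by (simp add: mult_assoc)
  finally show ?thesis by (simp add: mult_sinv_mult)
qed

lemma idem_mult_swap:
  assumes [simp]: "a \<in> carrier S" "e \<in> E"
  shows "e \<odot> a = a \<odot> (a\<^sup>\<star> \<odot> e \<odot> a)"
proof -
  have "a \<odot> (a\<^sup>\<star> \<odot> e \<odot> a) = ((a \<odot> a\<^sup>\<star>) \<odot> e) \<odot> a"
    by (simp add: mult_assoc)
  also have "\<dots> = e \<odot> (a \<odot> a\<^sup>\<star> \<odot> a)"
    unfolding idem_commute [OF sran_idem [OF assms(1)] \<open>e \<in> E\<close>] by (simp add: mult_assoc)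
  finally show ?thesis by (simp add: mult_sinv_mult)
qed

lemma mult_idem_le:
  assumes [simp]: "a \<in> carrier S" "e \<in> E"
  shows "a \<odot> e \<preceq> a"
proof -
  have "a \<odot> (a \<odot> e)\<^sup>\<star> \<odot> (a \<odot> e) = (a \<odot> e \<odot> a\<^sup>\<star>) \<odot> (a \<odot> e)"
    by (simp add: sinv_mult mult_assoc)
  also have "\<dots> = ((a \<odot> e \<odot> a\<^sup>\<star>) \<odot> a) \<odot> e"
    by (simp add: mult_assoc)
  also have "\<dots> = a \<odot> (e \<odot> e)"
    unfolding mult_idem_swap [symmetric, OF assms] by (simp add: mult_assoc)
  finally show ?thesis by (simp add: le_iff idem_idem)
qed

lemma idem_mult_le:
  assumes "a \<in> carrier S" "e \<in> E"
  shows "e \<odot> a \<preceq> a"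
  using mult_idem_le [of a "a\<^sup>\<star> \<odot> e \<odot> a"] conjugate_idem [of "a\<^sup>\<star>" e] assms
  by (simp add: idem_mult_swap [symmetric])

lemma le_iff_right:
  assumes "a \<in> carrier S" "b \<in> carrier S"
  shows "a \<preceq> b \<longleftrightarrow> (\<exists>e\<in>E. a = b \<odot> e)"
  using assms mult_idem_le [of b] le_iff [of a b] sdom_idem [of a] by (auto simp: mult_assoc)

lemma le_iff_left:
  assumes "a \<in> carrier S" "b \<in> carrier S"
  shows "a \<preceq> b \<longleftrightarrow> (\<exists>e\<in>E. a = e \<odot> b)"
  using assms idem_mult_le [of b] le_iff_right [of a b] mult_idem_swap [of b] conjugate_idem [of b]
  by metis

lemma le_refl [simp]: "a \<in> carrier S \<Longrightarrow> a \<preceq> a"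
  by (simp add: le_iff mult_sinv_mult)

lemma le_trans:
  assumes "a \<preceq> b" "b \<preceq> c" and [simp]: "a \<in> carrier S" "b \<in> carrier S" "c \<in> carrier S"
  shows "a \<preceq> c"
proof -
  obtain e f where "e \<in> E" "f \<in> E" "a = b \<odot> e" "b = c \<odot> f"
    using assms le_iff_right by metis
  then have "f \<odot> e \<in> E" "a = c \<odot> (f \<odot> e)"
    by (simp_all add: mult_assoc)
  then show ?thesis using le_iff_right assms by blast
qed

lemma le_antisym:
  assumes "a \<preceq> b" "b \<preceq> a" and [simp]: "a \<in> carrier S" "b \<in> carrier S"
  shows "a = b"
proof -
  obtain e f where [simp]: "e \<in> E" "f \<in> E" and a: "a = b \<odot> e" and b: "b = a \<odot> f"
    using assms le_iff_right by metis
  have "a = a \<odot> e"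
    using a idem_idem [of e] mult_assoc [of b e e] by simp
  then have "a \<odot> f = a \<odot> (e \<odot> f)"
    using mult_assoc [of a e f] by simp
  also have "\<dots> = (a \<odot> f) \<odot> e"
    using idem_commute [of e f] mult_assoc [of a f e] by simp
  finally show ?thesis using a b by metis
qed

lemma zero_le [simp]: "a \<in> carrier S \<Longrightarrow> \<zero> \<preceq> a"
  using le_iff_right [of \<zero> a] by (metis mult_zero zero_idem zero_closed)

lemma le_zero: "a \<in> carrier S \<Longrightarrow> a \<preceq> \<zero> \<Longrightarrow> a = \<zero>"
  using le_antisym by simp

lemma mult_left_mono:
  assumes "a \<preceq> b" and [simp]: "a \<in> carrier S" "b \<in> carrier S" "c \<in> carrier S"
  shows "c \<odot> a \<preceq> c \<odot> b"
proof -
  obtain e where "e \<in> E" "a = b \<odot> e" using assms le_iff_right by metis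
  then show ?thesis using mult_idem_le [of "c \<odot> b" e] by (simp add: mult_assoc)
qed

lemma mult_right_mono:
  assumes "a \<preceq> b" and [simp]: "a \<in> carrier S" "b \<in> carrier S" "c \<in> carrier S"
  shows "a \<odot> c \<preceq> b \<odot> c"
proof -
  obtain e where "e \<in> E" "a = e \<odot> b" using assms le_iff_left by metis
  then show ?thesis using idem_mult_le [of "b \<odot> c" e] by (simp add: mult_assoc)
qed

lemma mult_mono:
  assumes "a \<preceq> b" "c \<preceq> d"
    and "a \<in> carrier S" "b \<in> carrier S" "c \<in> carrier S" "d \<in> carrier S"
  shows "a \<odot> c \<preceq> b \<odot> d"
  using assms mult_right_mono [of a b c] mult_left_mono [of c d b]
  by (blast intro: le_trans mult_closed)

lemma sinv_mono:
  assumes "a \<preceq> b" and [simp]: "a \<in> carrier S" "b \<in> carrier S"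
  shows "a\<^sup>\<star> \<preceq> b\<^sup>\<star>"
proof -
  obtain e where "e \<in> E" "a = b \<odot> e" using assms le_iff_right by metis
  then show ?thesis using idem_mult_le [of "b\<^sup>\<star>" e] by (simp add: sinv_mult)
qed

lemma sinv_le_iff:
  assumes "a \<in> carrier S" "b \<in> carrier S"
  shows "a\<^sup>\<star> \<preceq> b \<longleftrightarrow> a \<preceq> b\<^sup>\<star>"
  using assms sinv_mono [of "a\<^sup>\<star>" b] sinv_mono [of a "b\<^sup>\<star>"] by auto

lemma le_idem_idem: "x \<preceq> e \<Longrightarrow> x \<in> carrier S \<Longrightarrow> e \<in> E \<Longrightarrow> x \<in> E"
  using le_iff_right [of x e] by auto

lemma le_eq_mult_sdom:
  "x \<preceq> a \<Longrightarrow> x \<in> carrier S \<Longrightarrow> a \<in> carrier S \<Longrightarrow> x = a \<odot> (x\<^sup>\<star> \<odot> x)"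
  by (simp add: le_iff mult_assoc)

lemma sdom_mono:
  "x \<preceq> a \<Longrightarrow> x \<in> carrier S \<Longrightarrow> a \<in> carrier S \<Longrightarrow> x\<^sup>\<star> \<odot> x \<preceq> a\<^sup>\<star> \<odot> a"
  by (simp add: mult_mono sinv_mono)

lemma sdom_eq_zero_iff: "a \<in> carrier S \<Longrightarrow> a\<^sup>\<star> \<odot> a = \<zero> \<longleftrightarrow> a = \<zero>"
  by (metis mult_assoc mult_sinv_mult mult_zero sinv_closed)

lemma idem_le_iff:
  assumes "e \<in> E" "f \<in> E"
  shows "e \<preceq> f \<longleftrightarrow> e \<odot> f = e"
proof
  assume "e \<preceq> f"
  then have "e = f \<odot> e" using assms le_eq_mult_sdom [of e f] by (simp add: idem_idem)
  then show "e \<odot> f = e" using assms idem_commute by simp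
next
  assume "e \<odot> f = e"
  then show "e \<preceq> f" using assms idem_mult_le [of f e] by simp
qed

lemma idem_meet_greatest:
  assumes "x \<preceq> e" "x \<preceq> f" "e \<in> E" "f \<in> E" "x \<in> carrier S"
  shows "x \<preceq> e \<odot> f"
proof -
  have "x \<in> E" using assms le_idem_idem by blast
  then show ?thesis using mult_mono [of x e x f] assms by (simp add: idem_idem)
qed

lemma idem_meet_le:
  assumes "e \<in> E" "f \<in> E"
  shows "e \<odot> f \<preceq> e" "e \<odot> f \<preceq> f"
  using assms by (simp_all add: mult_idem_le idem_mult_le)

lemma idem_compatible [simp]: "e \<in> E \<Longrightarrow> f \<in> E \<Longrightarrow> compatible S e f"
  by (simp add: compatible_def)

lemma nat_order_carrier [simp]: "carrier (nat_order S) = carrier S"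
  by (simp add: nat_order_def)

lemma up_set_up_set: "A \<subseteq> carrier S \<Longrightarrow> up_set S (up_set S A) = up_set S A"
  unfolding up_set_def by (blast intro: le_trans le_refl)

lemma mem_up_singleton: "a \<in> carrier S \<Longrightarrow> x \<in> up_set S {a} \<longleftrightarrow> x \<in> carrier S \<and> a \<preceq> x"
  by (auto simp: up_set_def)

lemma up_singleton_eq_iff:
  "a \<in> carrier S \<Longrightarrow> b \<in> carrier S \<Longrightarrow> up_set S {a} = up_set S {b} \<longleftrightarrow> a = b"
  by (metis le_antisym le_refl mem_up_singleton)

lemma up_singleton_filter: "a \<in> carrier S \<Longrightarrow> is_filter S (up_set S {a})"
  unfolding is_filter_def by (auto simp: up_set_up_set mem_up_singleton) (auto simp: up_set_def)

text \<open>A filter with an element of finite down-set is principal: below that element it contains an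
  element with a smallest possible down-set, and directedness puts it below every other member.\<close>

lemma filter_principal:
  assumes F: "is_filter S F" and a: "a \<in> F" and fin: "finite (down_set S a)"
  obtains b where "b \<in> F" "F = up_set S {b}"
proof -
  have FS: "F \<subseteq> carrier S" and up: "up_set S F = F"
    and dir: "\<And>x y. x \<in> F \<Longrightarrow> y \<in> F \<Longrightarrow> \<exists>c\<in>F. c \<preceq> x \<and> c \<preceq> y"
    using F unfolding is_filter_def by blast+
  have "a \<in> F \<and> a \<preceq> a" using a FS by auto
  then obtain b where b: "b \<in> F" "b \<preceq> a"
    and least: "\<And>c. c \<in> F \<Longrightarrow> c \<preceq> a \<Longrightarrow> card (down_set S b) \<le> card (down_set S c)"
    using ex_has_least_nat [of "\<lambda>c. c \<in> F \<and> c \<preceq> a" a "\<lambda>c. card (down_set S c)"] by blast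
  have [simp]: "b \<in> carrier S" "a \<in> carrier S" using a b FS by auto
  have down_mono: "down_set S x \<subseteq> down_set S y" if "x \<preceq> y" "x \<in> carrier S" "y \<in> carrier S" for x y
    using that unfolding down_set_def by (blast intro: le_trans)
  have "b \<preceq> x" if x: "x \<in> F" for x
  proof -
    obtain c where c: "c \<in> F" "c \<preceq> b" "c \<preceq> x" using dir b x by blast
    then have [simp]: "c \<in> carrier S" "x \<in> carrier S" using FS x by auto
    have "c \<preceq> a" using le_trans c b by simp
    then have "card (down_set S b) \<le> card (down_set S c)" using least c by blast
    moreover have "down_set S c \<subseteq> down_set S b" "finite (down_set S b)"
      using down_mono [of c b] down_mono [of b a] c b fin finite_subset by auto
    ultimately have "down_set S c = down_set S b" by (intro card_seteq)
    moreover have "b \<in> down_set S b" by (simp add: down_set_def)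
    ultimately have "b \<in> down_set S c" by simp
    then show ?thesis using le_trans [of b c x] c by (simp add: down_set_def)
  qed
  then have "F \<subseteq> up_set S {b}" using FS by (auto simp: mem_up_singleton)
  moreover have "up_set S {b} \<subseteq> F" using b(1) up unfolding up_set_def by blast
  ultimately show thesis using that b by blast
qed

section \<open>The groupoid of atoms\<close>

lemma atoms_iff:
  "a \<in> atoms S \<longleftrightarrow> a \<in> carrier S \<and> a \<noteq> \<zero> \<and> (\<forall>x\<in>carrier S. x \<preceq> a \<longrightarrow> x = a \<or> x = \<zero>)"
  by (simp add: atoms_def)

lemma atom_closed: "a \<in> atoms S \<Longrightarrow> a \<in> carrier S"
  by (simp add: atoms_iff)

lemma atom_sinv:
  assumes a: "a \<in> atoms S"
  shows "a\<^sup>\<star> \<in> atoms S"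
proof -
  have [simp]: "a \<in> carrier S" using a by (simp add: atoms_iff)
  have "x = a\<^sup>\<star> \<or> x = \<zero>" if x: "x \<in> carrier S" "x \<preceq> a\<^sup>\<star>" for x
  proof -
    have "x\<^sup>\<star> = a \<or> x\<^sup>\<star> = \<zero>"
      using a x sinv_le_iff [of x a] by (simp add: atoms_iff)
    then show ?thesis using sinv_sinv [OF x(1)] sinv_idem [OF zero_idem] by metis
  qed
  moreover have "a\<^sup>\<star> \<noteq> \<zero>"
    using a sinv_sinv [of a] sinv_idem [OF zero_idem] by (auto simp: atoms_iff simp del: sinv_sinv)
  ultimately show ?thesis by (simp add: atoms_iff)
qed

text \<open>Anything below \<open>a \<odot> b\<close> has the form \<open>a \<odot> y\<close> with \<open>y\<close> below \<open>b\<close>, so left multiplication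
  turns the atom \<open>b\<close> into an atom or into \<open>\<zero>\<close>.\<close>

lemma atom_mult:
  assumes a: "a \<in> carrier S" and b: "b \<in> atoms S" and nz: "a \<odot> b \<noteq> \<zero>"
  shows "a \<odot> b \<in> atoms S"
proof -
  have [simp]: "a \<in> carrier S" "b \<in> carrier S" using a b by (auto simp: atoms_iff)
  have "x = a \<odot> b \<or> x = \<zero>" if x: "x \<in> carrier S" "x \<preceq> a \<odot> b" for x
  proof -
    obtain e where e: "e \<in> E" "x = a \<odot> b \<odot> e"
      using le_iff_right [of x "a \<odot> b"] x by auto
    then have "b \<odot> e = b \<or> b \<odot> e = \<zero>"
      using b mult_idem_le [of b e] by (simp add: atoms_iff)
    then show ?thesis using e by (auto simp: mult_assoc)
  qed
  then show ?thesis using nz by (simp add: atoms_iff)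
qed

lemma atom_sdom: "a \<in> atoms S \<Longrightarrow> a\<^sup>\<star> \<odot> a \<in> atoms S"
  using atom_mult [of "a\<^sup>\<star>" a] sdom_eq_zero_iff [of a] by (auto simp: atoms_iff)

lemma atom_sran: "a \<in> atoms S \<Longrightarrow> a \<odot> a\<^sup>\<star> \<in> atoms S"
  using atom_sdom [OF atom_sinv] by (simp add: atom_closed)

lemma sdom_mult:
  assumes [simp]: "a \<in> carrier S" "b \<in> carrier S" and ab: "a\<^sup>\<star> \<odot> a = b \<odot> b\<^sup>\<star>"
  shows "(a \<odot> b)\<^sup>\<star> \<odot> (a \<odot> b) = b\<^sup>\<star> \<odot> b"
proof -
  have "(a \<odot> b)\<^sup>\<star> \<odot> (a \<odot> b) = b\<^sup>\<star> \<odot> (a\<^sup>\<star> \<odot> a) \<odot> b"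
    by (simp add: sinv_mult mult_assoc)
  also have "\<dots> = (b\<^sup>\<star> \<odot> b \<odot> b\<^sup>\<star>) \<odot> b"
    unfolding ab by (simp add: mult_assoc)
  finally show ?thesis by (simp add: sinv_mult_sinv)
qed

lemma sran_mult:
  assumes [simp]: "a \<in> carrier S" "b \<in> carrier S" and ab: "a\<^sup>\<star> \<odot> a = b \<odot> b\<^sup>\<star>"
  shows "(a \<odot> b) \<odot> (a \<odot> b)\<^sup>\<star> = a \<odot> a\<^sup>\<star>"
  using sdom_mult [of "b\<^sup>\<star>" "a\<^sup>\<star>"] ab by (simp add: sinv_mult)

lemma groupoid_atoms: "groupoid (atom_groupoid S)"
proof -
  have idem: "sdom S e = e" "sran S e = e" if "e \<in> E" for e
    using that by (simp_all add: sdom_def sran_def idem_idem)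
  show ?thesis
  proof (rule groupoid.intro, simp_all add: atom_groupoid_def)
    fix x y assume xy: "x \<in> atoms S" "y \<in> atoms S" "sdom S x = sran S y"
    then have c: "x \<in> carrier S" "y \<in> carrier S" "x\<^sup>\<star> \<odot> x = y \<odot> y\<^sup>\<star>"
      by (simp_all add: atom_closed sdom_def sran_def)
    show "sdom S (x \<odot> y) = sdom S y" "sran S (x \<odot> y) = sran S x"
      using sdom_mult [OF c] sran_mult [OF c] by (simp_all add: sdom_def sran_def)
    have "x \<odot> y \<noteq> \<zero>"
      using sdom_mult [OF c] sdom_eq_zero_iff [of "x \<odot> y"] sdom_eq_zero_iff [of y] c xy(2)
      by (simp add: atoms_iff)
    then show "x \<odot> y \<in> atoms S" using atom_mult c(1) xy(2) by blast
  next
    fix x assume x: "x \<in> atoms S"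
    then have [simp]: "x \<in> carrier S" by (simp add: atom_closed)
    show "sdom S x \<in> atoms S" "sran S x \<in> atoms S"
      using x by (simp_all add: atom_sdom atom_sran sdom_def sran_def)
    have "sdom S x \<in> E" "sran S x \<in> E" by (simp_all add: sdom_def sran_def)
    then show "sdom S (sdom S x) = sdom S x" "sran S (sdom S x) = sdom S x"
      "sdom S (sran S x) = sran S x" "sran S (sran S x) = sran S x"
      by (simp_all add: idem)
    show "x \<odot> sdom S x = x" "sran S x \<odot> x = x"
      by (simp_all add: sdom_def sran_def mult_sinv_mult mult_assoc [symmetric])
    show "\<exists>y\<in>atoms S. sdom S y = sran S x \<and> sran S y = sdom S x \<and>
            x \<odot> y = sran S x \<and> y \<odot> x = sdom S x"
      using atom_sinv [OF x] by (intro bexI [of _ "x\<^sup>\<star>"]) (simp_all add: sdom_def sran_def)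
  qed (simp_all add: mult_assoc atom_closed)
qed

text \<open>Inversion and multiplication of principal filters amount to the same operations on their
  least elements; this is what makes \<open>a \<mapsto> up_set S {a}\<close> compatible with the groupoid
  structures.\<close>

lemma sinv_image_up: "a \<in> carrier S \<Longrightarrow> sinv S ` up_set S {a} = up_set S {a\<^sup>\<star>}"
proof (intro subset_antisym subsetI)
  fix x assume "a \<in> carrier S" "x \<in> up_set S {a\<^sup>\<star>}"
  then have "x\<^sup>\<star> \<in> up_set S {a}" "x = (x\<^sup>\<star>)\<^sup>\<star>"
    using sinv_le_iff [of a x] by (simp_all add: mem_up_singleton)
  then show "x \<in> sinv S ` up_set S {a}" by blast
qed (auto simp: mem_up_singleton sinv_mono)

lemma up_set_mult:
  assumes [simp]: "a \<in> carrier S" "b \<in> carrier S"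
  shows "up_set S (set_mult S (up_set S {a}) (up_set S {b})) = up_set S {a \<odot> b}"
proof (intro subset_antisym subsetI)
  fix x assume "x \<in> up_set S (set_mult S (up_set S {a}) (up_set S {b}))"
  then obtain c d where "c \<in> carrier S" "d \<in> carrier S" "a \<preceq> c" "b \<preceq> d" "c \<odot> d \<preceq> x"
    and "x \<in> carrier S"
    by (auto simp: up_set_def set_mult_def)
  moreover from this have "a \<odot> b \<preceq> c \<odot> d" by (simp add: mult_mono)
  ultimately show "x \<in> up_set S {a \<odot> b}"
    using le_trans [of "a \<odot> b" "c \<odot> d" x] by (simp add: mem_up_singleton)
next
  fix x assume "x \<in> up_set S {a \<odot> b}"
  moreover have "a \<in> up_set S {a}" "b \<in> up_set S {b}" by (simp_all add: mem_up_singleton)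
  ultimately show "x \<in> up_set S (set_mult S (up_set S {a}) (up_set S {b}))"
    unfolding up_set_def set_mult_def by blast
qed

end

text \<open>The groupoid axioms are transported along the bijection \<open>h\<close>, so only one of the two
  structures has to be known to be a groupoid beforehand.\<close>

lemma isomorphic_groupoidsI:
  assumes H: "groupoid H" and bij: "bij_betw h (carrier H) (carrier G)"
    and d: "\<And>a. a \<in> carrier H \<Longrightarrow> gdom G (h a) = h (gdom H a)"
    and r: "\<And>a. a \<in> carrier H \<Longrightarrow> gran G (h a) = h (gran H a)"
    and c: "\<And>a b. a \<in> carrier H \<Longrightarrow> b \<in> carrier H \<Longrightarrow> gdom H a = gran H b \<Longrightarrow>
              gcomp G (h a) (h b) = h (gcomp H a b)"
  shows "isomorphic_groupoids G H"
proof -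
  interpret H: groupoid H by (rule H)
  have G: "carrier G = h ` carrier H" using bij by (simp add: bij_betw_def)
  have inj: "h a = h b \<longleftrightarrow> a = b" if "a \<in> carrier H" "b \<in> carrier H" for a b
    using bij that by (meson bij_betw_def inj_on_eq_iff)
  note [simp] = d r c inj H.dom_closed H.ran_closed H.dom_dom H.ran_dom H.dom_ran H.ran_ran
    H.comp_closed H.dom_comp H.ran_comp H.comp_dom H.ran_comp_self
  have "groupoid G"
  proof
    fix x assume "x \<in> carrier G"
    then obtain a where a: "a \<in> carrier H" "x = h a" using G by blast
    obtain b where "b \<in> carrier H" "gdom H b = gran H a" "gran H b = gdom H a"
      "gcomp H a b = gran H a" "gcomp H b a = gdom H a"
      using H.inverse_exists [OF a(1)] by blast
    then show "\<exists>y\<in>carrier G. gdom G y = gran G x \<and> gran G y = gdom G x \<and>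
            gcomp G x y = gran G x \<and> gcomp G y x = gdom G x"
      using a by (auto simp: G)
  qed (auto simp: G H.comp_assoc)
  moreover have "groupoid_functor G H (the_inv_into (carrier H) h)"
  proof -
    have k: "the_inv_into (carrier H) h (h a) = a" if "a \<in> carrier H" for a
      using that bij by (simp add: bij_betw_def the_inv_into_f_f)
    show ?thesis unfolding groupoid_functor_def by (auto simp: G k)
  qed
  moreover have "bij_betw (the_inv_into (carrier H) h) (carrier G) (carrier H)"
    by (rule bij_betw_the_inv_into [OF bij])
  ultimately show ?thesis using H unfolding isomorphic_groupoids_def by blast
qed

section \<open>Joins and prime filters\<close>

context distributive_inverse_semigroup
begin

lemma join_props:
  assumes "a \<in> carrier S" "b \<in> carrier S" "compatible S a b"
  shows join_closed [simp]: "a \<uplus> b \<in> carrier S"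
    and join_upper1: "a \<preceq> a \<uplus> b"
    and join_upper2: "b \<preceq> a \<uplus> b"
    and join_least: "\<And>u. u \<in> carrier S \<Longrightarrow> a \<preceq> u \<Longrightarrow> b \<preceq> u \<Longrightarrow> a \<uplus> b \<preceq> u"
proof -
  have "least (nat_order S) (a \<uplus> b) (Upper (nat_order S) {a, b})"
    unfolding join_def sup_def by (rule someI_ex) (rule compatible_join_exists [OF assms])
  then have l: "a \<uplus> b \<in> Upper (nat_order S) {a, b}"
      "\<And>u. u \<in> Upper (nat_order S) {a, b} \<Longrightarrow> a \<uplus> b \<preceq> u"
    unfolding least_def by blast+
  show "a \<uplus> b \<in> carrier S" "a \<preceq> a \<uplus> b" "b \<preceq> a \<uplus> b"
    using l(1) assms by (auto simp: Upper_def)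
  show "a \<uplus> b \<preceq> u" if "u \<in> carrier S" "a \<preceq> u" "b \<preceq> u" for u
    using l(2) that by (auto simp: Upper_def)
qed

text \<open>The domain of a join of idempotents is an idempotent upper bound of both, hence lies above
  the join.\<close>

lemma join_idem [simp]:
  assumes "e \<in> E" "f \<in> E"
  shows "e \<uplus> f \<in> E"
proof -
  define j where "j = e \<uplus> f"
  have [simp]: "j \<in> carrier S" using assms by (simp add: j_def)
  have "e \<preceq> j" "f \<preceq> j" unfolding j_def using assms by (simp_all add: join_upper1 join_upper2)
  then have "e \<preceq> j\<^sup>\<star> \<odot> j" "f \<preceq> j\<^sup>\<star> \<odot> j"
    using sdom_mono [of e j] sdom_mono [of f j] assms by (simp_all add: idem_idem)
  then have "e \<uplus> f \<preceq> j\<^sup>\<star> \<odot> j"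
    using assms by (intro join_least) simp_all
  then show ?thesis using le_idem_idem [of j "j\<^sup>\<star> \<odot> j"] by (simp add: j_def [symmetric])
qed

lemma idem_join_upper:
  assumes "e \<in> E" "f \<in> E"
  shows "e \<preceq> e \<uplus> f" "f \<preceq> e \<uplus> f"
  using assms by (simp_all add: join_upper1 join_upper2)

lemma idem_join_least:
  "e \<preceq> u \<Longrightarrow> f \<preceq> u \<Longrightarrow> e \<in> E \<Longrightarrow> f \<in> E \<Longrightarrow> u \<in> carrier S \<Longrightarrow> e \<uplus> f \<preceq> u"
  by (simp add: join_least)

lemma idem_join_mono:
  assumes "e \<preceq> g" "f \<preceq> h" "e \<in> E" "f \<in> E" "g \<in> E" "h \<in> E"
  shows "e \<uplus> f \<preceq> g \<uplus> h"
  using assms idem_join_upper [of g h] by (blast intro: idem_join_least le_trans idem_closed join_idem)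

text \<open>Ideals of the lattice of idempotents. The join is taken in the whole semigroup, which for
  idempotents gives the same element as the join among idempotents.\<close>

definition idem_ideal :: "'a set \<Rightarrow> bool" where
  "idem_ideal I \<longleftrightarrow> I \<subseteq> E \<and> \<zero> \<in> I \<and> (\<forall>e\<in>I. \<forall>f\<in>E. f \<preceq> e \<longrightarrow> f \<in> I) \<and>
     (\<forall>e\<in>I. \<forall>f\<in>I. e \<uplus> f \<in> I)"

lemma idem_idealD:
  assumes "idem_ideal I"
  shows "I \<subseteq> E" "\<zero> \<in> I" "\<And>e f. e \<in> I \<Longrightarrow> f \<in> E \<Longrightarrow> f \<preceq> e \<Longrightarrow> f \<in> I"
    "\<And>e f. e \<in> I \<Longrightarrow> f \<in> I \<Longrightarrow> e \<uplus> f \<in> I"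
  using assms unfolding idem_ideal_def by blast+

lemma idem_ideal_down: "e \<in> E \<Longrightarrow> idem_ideal {f \<in> E. f \<preceq> e}"
  unfolding idem_ideal_def by (auto intro: idem_join_least le_trans idem_closed)

text \<open>If \<open>f \<preceq> a \<uplus> b\<close> with \<open>f\<close> idempotent, then \<open>f\<close> is the join of \<open>a \<odot> f\<close> and \<open>b \<odot> f\<close>, and
  these are idempotents because they lie below \<open>f\<close>. So the primeness that has to be checked for
  elements of \<open>S\<close> reduces to closure of \<open>M\<close> under joins of idempotents.\<close>

lemma up_set_prime_filter:
  assumes M: "idem_ideal M" and e: "e \<in> E" "e \<notin> M"
    and prime: "\<And>f g. f \<in> E \<Longrightarrow> g \<in> E \<Longrightarrow> f \<odot> g \<in> M \<Longrightarrow> f \<in> M \<or> g \<in> M"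
  shows "up_set S (E - M) \<in> prime_filters S"
proof -
  note MD = idem_idealD [OF M]
  let ?F = "up_set S (E - M)"
  have F: "x \<in> ?F \<longleftrightarrow> x \<in> carrier S \<and> (\<exists>f\<in>E. f \<notin> M \<and> f \<preceq> x)" for x
    by (auto simp: up_set_def)
  have "up_set S ?F = ?F" by (rule up_set_up_set) auto
  moreover have "e \<in> ?F" using e le_refl [of e] F by auto
  moreover have "\<exists>c\<in>?F. c \<preceq> x \<and> c \<preceq> y" if xy: "x \<in> ?F" "y \<in> ?F" for x y
  proof -
    obtain f g where fg: "f \<in> E" "f \<notin> M" "f \<preceq> x" "g \<in> E" "g \<notin> M" "g \<preceq> y"
      and [simp]: "x \<in> carrier S" "y \<in> carrier S"
      using xy F by blast
    have "f \<odot> g \<preceq> x" "f \<odot> g \<preceq> y"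
      using fg idem_meet_le [of f g] le_trans [of "f \<odot> g" f x] le_trans [of "f \<odot> g" g y] by simp_all
    moreover have "f \<odot> g \<in> ?F"
      using F fg prime le_refl [of "f \<odot> g"] by (meson idem_closed idem_mult)
    ultimately show ?thesis by blast
  qed
  ultimately have filter: "is_filter S ?F"
    unfolding is_filter_def using F by blast
  have "\<zero> \<notin> ?F"
    using F MD(2) le_zero idem_closed by metis
  moreover have "a \<in> ?F \<or> b \<in> ?F"
    if ab: "a \<in> carrier S" "b \<in> carrier S" "compatible S a b" and j: "a \<uplus> b \<in> ?F" for a b
  proof -
    obtain f where f: "f \<in> E" "f \<notin> M" "f \<preceq> a \<uplus> b" using j F by blast
    have feq: "f = (a \<uplus> b) \<odot> f"
      using le_eq_mult_sdom [OF f(3)] f(1) join_closed [OF ab] by (simp add: idem_idem)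
    have "a \<odot> f \<preceq> (a \<uplus> b) \<odot> f" "b \<odot> f \<preceq> (a \<uplus> b) \<odot> f"
      using ab f(1) by (simp_all add: mult_right_mono join_upper1 join_upper2)
    then have "a \<odot> f \<preceq> f" "b \<odot> f \<preceq> f" unfolding feq [symmetric] .
    then have afbf: "a \<odot> f \<in> E" "b \<odot> f \<in> E"
      using ab f(1) by (auto intro: le_idem_idem)
    have "(a \<odot> f) \<uplus> (b \<odot> f) = f"
      using mult_join_right [OF ab(1,2) _ ab(3), of f] f(1) feq by simp
    then have "a \<odot> f \<notin> M \<or> b \<odot> f \<notin> M"
      using MD(4) f(2) by metis
    then show ?thesis
      using F afbf ab f(1) mult_idem_le by blast
  qed
  ultimately show ?thesis
    unfolding prime_filters_def using filter by blast
qed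

text \<open>An ideal of idempotents that is maximal among those avoiding \<open>e\<close> is prime: adjoining \<open>f\<close> or
  \<open>g\<close> to it captures \<open>e\<close>, so \<open>e \<preceq> n \<uplus> f\<close> and \<open>e \<preceq> n \<uplus> g\<close> for a member \<open>n\<close>, and by distributivity
  \<open>e \<preceq> n \<uplus> f \<odot> g\<close>, so that \<open>f \<odot> g\<close> is not a member.\<close>

lemma prime_filter_separation:
  assumes I: "idem_ideal I" and e: "e \<in> E" "e \<notin> I"
  shows "\<exists>F\<in>prime_filters S. e \<in> F \<and> F \<inter> I = {}"
proof -
  define \<A> where "\<A> = {J. idem_ideal J \<and> I \<subseteq> J \<and> e \<notin> J}"
  have "\<exists>M\<in>\<A>. \<forall>X\<in>\<A>. M \<subseteq> X \<longrightarrow> X = M"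
  proof (rule subset_Zorn_nonempty)
    show "\<A> \<noteq> {}" using I e by (auto simp: \<A>_def)
  next
    fix \<C> assume ne: "\<C> \<noteq> {}" and ch: "subset.chain \<A> \<C>"
    have C: "\<C> \<subseteq> \<A>" and lin: "\<And>X Y. X \<in> \<C> \<Longrightarrow> Y \<in> \<C> \<Longrightarrow> X \<subseteq> Y \<or> Y \<subseteq> X"
      using ch unfolding subset_chain_def by blast+
    have id: "idem_ideal J" if "J \<in> \<C>" for J using that C by (auto simp: \<A>_def)
    have "idem_ideal (\<Union>\<C>)"
      unfolding idem_ideal_def
    proof (intro conjI ballI impI)
      show "\<Union>\<C> \<subseteq> E" using idem_idealD(1) [OF id] by blast
      show "\<zero> \<in> \<Union>\<C>" using ne idem_idealD(2) [OF id] by blast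
      show "f \<in> \<Union>\<C>" if "x \<in> \<Union>\<C>" "f \<in> E" "f \<preceq> x" for x f
        using that idem_idealD(3) [OF id] by blast
      show "x \<uplus> y \<in> \<Union>\<C>" if xy: "x \<in> \<Union>\<C>" "y \<in> \<Union>\<C>" for x y
      proof -
        obtain X Y where "X \<in> \<C>" "Y \<in> \<C>" "x \<in> X" "y \<in> Y" using xy by blast
        then obtain Z where "Z \<in> \<C>" "x \<in> Z" "y \<in> Z" using lin by blast
        then show ?thesis using idem_idealD(4) [OF id] by blast
      qed
    qed
    then show "\<Union>\<C> \<in> \<A>" using C ne by (auto simp: \<A>_def)
  qed
  then obtain M where "M \<in> \<A>" and maxA: "\<And>X. X \<in> \<A> \<Longrightarrow> M \<subseteq> X \<Longrightarrow> X = M"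
    by blast
  then have M: "idem_ideal M" "I \<subseteq> M" "e \<notin> M"
    by (simp_all add: \<A>_def)
  have max: "X = M" if "idem_ideal X" "M \<subseteq> X" "e \<notin> X" for X
    using maxA [of X] that M(2) by (auto simp: \<A>_def)
  note MD = idem_idealD [OF M(1)]
  have capture: "\<exists>m\<in>M. e \<preceq> m \<uplus> f" if f: "f \<in> E" "f \<notin> M" for f
  proof (rule ccontr)
    assume no: "\<not> (\<exists>m\<in>M. e \<preceq> m \<uplus> f)"
    let ?J = "{x \<in> E. \<exists>m\<in>M. x \<preceq> m \<uplus> f}"
    have "idem_ideal ?J"
      unfolding idem_ideal_def
    proof (intro conjI ballI impI)
      show "\<zero> \<in> ?J" using MD(2) f by (auto intro: bexI [of _ \<zero>])
      show "y \<in> ?J" if "x \<in> ?J" "y \<in> E" "y \<preceq> x" for x y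
        using that MD(1) f by (blast intro: le_trans idem_closed join_idem)
      show "x \<uplus> y \<in> ?J" if xy: "x \<in> ?J" "y \<in> ?J" for x y
      proof -
        obtain m n where mn: "m \<in> M" "x \<preceq> m \<uplus> f" "n \<in> M" "y \<preceq> n \<uplus> f" using xy by blast
        have E: "m \<in> E" "n \<in> E" "x \<in> E" "y \<in> E" using mn MD(1) xy by blast+
        have "m \<uplus> f \<preceq> (m \<uplus> n) \<uplus> f" "n \<uplus> f \<preceq> (m \<uplus> n) \<uplus> f"
          using E f by (simp_all add: idem_join_mono idem_join_upper)
        then have "x \<preceq> (m \<uplus> n) \<uplus> f" "y \<preceq> (m \<uplus> n) \<uplus> f"
          using mn E f by (meson le_trans idem_closed join_idem)+
        then have "x \<uplus> y \<preceq> (m \<uplus> n) \<uplus> f" using E f by (simp add: idem_join_least)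
        then show ?thesis using MD(4) [OF mn(1,3)] E by auto
      qed
    qed auto
    moreover have "M \<subseteq> ?J" using MD(1) f idem_join_upper(1) by blast
    moreover have "e \<notin> ?J" using no by blast
    ultimately have "?J = M" using max by blast
    moreover have "f \<in> ?J" using f MD(1,2) idem_join_upper(2) zero_idem by blast
    ultimately show False using f by blast
  qed
  have "f \<in> M \<or> g \<in> M" if fg: "f \<in> E" "g \<in> E" "f \<odot> g \<in> M" for f g
  proof (rule ccontr)
    assume "\<not> (f \<in> M \<or> g \<in> M)"
    then obtain m k where mk: "m \<in> M" "e \<preceq> m \<uplus> f" "k \<in> M" "e \<preceq> k \<uplus> g"
      using capture fg by blast
    define n where "n = m \<uplus> k"
    have nM: "n \<in> M" using MD(4) mk by (simp add: n_def)
    have E: "m \<in> E" "k \<in> E" "n \<in> E" using mk nM MD(1) by auto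
    have "m \<preceq> n" "k \<preceq> n" using E idem_join_upper [of m k] by (simp_all add: n_def)
    then have "m \<uplus> f \<preceq> n \<uplus> f" "k \<uplus> g \<preceq> n \<uplus> g" using E fg by (simp_all add: idem_join_mono)
    then have "e \<preceq> n \<uplus> f" "e \<preceq> n \<uplus> g"
      using mk E fg e by (meson le_trans idem_closed join_idem)+
    then have "e \<preceq> (n \<uplus> f) \<odot> (n \<uplus> g)" using E fg e by (simp add: idem_meet_greatest)
    also have "(n \<uplus> f) \<odot> (n \<uplus> g) = (n \<odot> (n \<uplus> g)) \<uplus> ((f \<odot> n) \<uplus> (f \<odot> g))"
      using E fg mult_join_right [of n f "n \<uplus> g"] mult_join_left [of n g f] by simp
    finally have le: "e \<preceq> (n \<odot> (n \<uplus> g)) \<uplus> ((f \<odot> n) \<uplus> (f \<odot> g))" .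
    have "n \<odot> (n \<uplus> g) \<in> M" "f \<odot> n \<in> M"
      using MD(3) [OF nM] E fg idem_meet_le by (meson idem_mult join_idem)+
    then have "(n \<odot> (n \<uplus> g)) \<uplus> ((f \<odot> n) \<uplus> (f \<odot> g)) \<in> M" using MD(4) fg(3) by blast
    then show False using le MD(3) e M(3) by blast
  qed
  then have "up_set S (E - M) \<in> prime_filters S"
    using up_set_prime_filter [OF M(1) e(1) M(3)] by blast
  moreover have "e \<in> up_set S (E - M)"
    using e M(3) by (auto simp: up_set_def intro: bexI [of _ e])
  moreover have "up_set S (E - M) \<inter> I = {}"
    using M(2) MD(3) unfolding up_set_def by blast
  ultimately show ?thesis by blast
qed

section \<open>A discrete space of prime filters forces finite down-sets\<close>

lemma open_singleton_iff:
  "openin (prime_filter_topology S) {F} \<longleftrightarrow> (\<exists>a\<in>carrier S. basic_open S a = {F})"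
proof
  assume "openin (prime_filter_topology S) {F}"
  then obtain \<U> where "\<U> \<subseteq> {U. \<exists>a\<in>carrier S. U = basic_open S a}" "\<Union>\<U> = {F}"
    unfolding openin_prime_filter_topology union_of_def by blast
  moreover from this obtain U where "U \<in> \<U>" "F \<in> U" by blast
  ultimately have "U = {F}" "\<exists>a\<in>carrier S. U = basic_open S a" by blast+
  then show "\<exists>a\<in>carrier S. basic_open S a = {F}" by auto
next
  assume "\<exists>a\<in>carrier S. basic_open S a = {F}"
  then show "openin (prime_filter_topology S) {F}"
    unfolding openin_prime_filter_topology by (intro arbitrary_union_of_inc) auto
qed

lemma discrete_iff:
  "prime_filter_topology S = discrete_topology (prime_filters S) \<longleftrightarrow>
     (\<forall>F\<in>prime_filters S. \<exists>a\<in>carrier S. basic_open S a = {F})"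
  by (metis discrete_topology_unique open_singleton_iff topspace_prime_filter_topology)

text \<open>Distributivity gives \<open>x = x \<odot> e \<uplus> x \<odot> f\<close> for every \<open>x\<close> below \<open>e \<uplus> f\<close>, so there are at most
  as many such \<open>x\<close> as pairs of an element below \<open>e\<close> and an element below \<open>f\<close>.\<close>

lemma finite_down_join:
  assumes e: "e \<in> E" "finite (down_set S e)" and f: "f \<in> E" "finite (down_set S f)"
  shows "finite (down_set S (e \<uplus> f))"
proof -
  have "down_set S (e \<uplus> f) \<subseteq> (\<lambda>(x, y). x \<uplus> y) ` (down_set S e \<times> down_set S f)"
  proof
    fix x assume "x \<in> down_set S (e \<uplus> f)"
    then have x: "x \<in> E" "x \<preceq> e \<uplus> f"
      using e f le_idem_idem by (auto simp: down_set_def)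
    then have "x = x \<odot> (e \<uplus> f)" using e f idem_le_iff by simp
    also have "\<dots> = (x \<odot> e) \<uplus> (x \<odot> f)" using x e f by (simp add: mult_join_left)
    finally have "x = (x \<odot> e) \<uplus> (x \<odot> f)" .
    moreover have "x \<odot> e \<in> down_set S e" "x \<odot> f \<in> down_set S f"
      using x e f idem_meet_le by (simp_all add: down_set_def)
    ultimately show "x \<in> (\<lambda>(x, y). x \<uplus> y) ` (down_set S e \<times> down_set S f)" by force
  qed
  then show ?thesis using e f by (meson finite_SigmaI finite_imageI finite_subset)
qed

lemma finite_down_ideal: "idem_ideal {e \<in> E. finite (down_set S e)}"
  unfolding idem_ideal_def
proof (intro conjI ballI impI)
  have "down_set S \<zero> \<subseteq> {\<zero>}" using le_zero by (auto simp: down_set_def)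
  then show "\<zero> \<in> {e \<in> E. finite (down_set S e)}" using finite_subset by auto
next
  fix e f assume ef: "e \<in> {e \<in> E. finite (down_set S e)}" "f \<in> E" "f \<preceq> e"
  then have "down_set S f \<subseteq> down_set S e"
    by (auto simp: down_set_def intro: le_trans [of _ f e])
  then show "f \<in> {e \<in> E. finite (down_set S e)}" using ef finite_subset by auto
qed (auto simp: finite_down_join)

text \<open>An element \<open>x\<close> below \<open>a\<close> is determined by its domain, which lies below the domain of
  \<open>a\<close>.\<close>

lemma semisimple_if_idem:
  assumes "\<And>e. e \<in> E \<Longrightarrow> finite (down_set S e)"
  shows "semisimple S"
  unfolding semisimple_def
proof
  fix a assume a: "a \<in> carrier S"
  have "down_set S a \<subseteq> (\<lambda>x. a \<odot> x) ` down_set S (a\<^sup>\<star> \<odot> a)"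
  proof
    fix x assume "x \<in> down_set S a"
    then have x: "x \<in> carrier S" "x \<preceq> a" by (simp_all add: down_set_def)
    then have "x\<^sup>\<star> \<odot> x \<in> down_set S (a\<^sup>\<star> \<odot> a)" using a by (simp add: down_set_def sdom_mono)
    then show "x \<in> (\<lambda>x. a \<odot> x) ` down_set S (a\<^sup>\<star> \<odot> a)"
      by (rule rev_image_eqI) (rule le_eq_mult_sdom [OF x(2,1) a])
  qed
  then show "finite (down_set S a)" using assms a by (meson finite_imageI finite_subset sdom_idem)
qed

text \<open>If \<open>f\<close> lies in exactly one prime filter, a nonzero \<open>c \<preceq> f\<close> lies in it as well; but if
  \<open>c \<noteq> f\<close>, separation also provides a prime filter containing \<open>f\<close> and not \<open>c\<close>.\<close>

lemma atom_if_isolated: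
  assumes f: "f \<in> E" and iso: "basic_open S f = {F}"
  shows "f \<in> atoms S"
proof -
  have F: "G = F" if "G \<in> prime_filters S" "f \<in> G" for G
    using that iso by (auto simp: basic_open_def)
  have mem: "F \<in> prime_filters S" "f \<in> F" using iso by (auto simp: basic_open_def)
  have "c = f \<or> c = \<zero>" if c: "c \<in> carrier S" "c \<preceq> f" for c
  proof (rule ccontr)
    assume no: "\<not> (c = f \<or> c = \<zero>)"
    have cE: "c \<in> E" using c f le_idem_idem by blast
    have "c \<notin> {g \<in> E. g \<preceq> \<zero>}" using no le_zero c by blast
    then obtain G where G: "G \<in> prime_filters S" "c \<in> G"
      using prime_filter_separation [OF idem_ideal_down [OF zero_idem] cE] by blast
    then have "up_set S G = G" by (simp add: prime_filters_def is_filter_def)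
    then have "f \<in> G" using G c f idem_closed [OF f] unfolding up_set_def by blast
    then have "c \<in> F" using F G by blast
    have "f \<notin> {g \<in> E. g \<preceq> c}" using no c f le_antisym idem_closed by blast
    then obtain H where "H \<in> prime_filters S" "f \<in> H" "c \<notin> H"
      using prime_filter_separation [OF idem_ideal_down [OF cE] f] cE le_refl [of c] c(1) by blast
    then show False using F \<open>c \<in> F\<close> by blast
  qed
  moreover have "f \<noteq> \<zero>" using mem by (auto simp: prime_filters_def)
  ultimately show ?thesis using f by (auto simp: atoms_iff)
qed

lemma semisimple_if_discrete:
  assumes discrete: "\<And>F. F \<in> prime_filters S \<Longrightarrow> \<exists>a\<in>carrier S. basic_open S a = {F}"
  shows "semisimple S"
proof (rule semisimple_if_idem, rule ccontr)
  fix e assume e: "e \<in> E" "infinite (down_set S e)"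
  let ?I = "{e \<in> E. finite (down_set S e)}"
  obtain F where F: "F \<in> prime_filters S" "e \<in> F" "F \<inter> ?I = {}"
    using prime_filter_separation [OF finite_down_ideal e(1)] e(2) by blast
  obtain a where a: "a \<in> carrier S" "basic_open S a = {F}" using discrete F by blast
  have filt: "F \<subseteq> carrier S" "up_set S F = F"
    and dir: "\<And>x y. x \<in> F \<Longrightarrow> y \<in> F \<Longrightarrow> \<exists>c\<in>F. c \<preceq> x \<and> c \<preceq> y"
    using F(1) unfolding prime_filters_def is_filter_def by blast+
  have "a \<in> F" using a by (auto simp: basic_open_def)
  \<comment> \<open>As \<open>F\<close> contains the idempotent \<open>e\<close>, the isolating element can be taken below \<open>e\<close>.\<close>
  then obtain f where f: "f \<in> F" "f \<preceq> a" "f \<preceq> e" using dir F(2) by blast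
  have fE: "f \<in> E" using f filt e le_idem_idem by blast
  have "G \<in> basic_open S a" if "G \<in> basic_open S f" for G
  proof -
    have "up_set S G = G" "f \<in> G" "G \<in> prime_filters S"
      using that by (auto simp: basic_open_def prime_filters_def is_filter_def)
    then show ?thesis using a(1) f(2) unfolding basic_open_def up_set_def by blast
  qed
  then have "basic_open S f = {F}" using a(2) f(1) F(1) by (auto simp: basic_open_def)
  then have "f \<in> atoms S" using atom_if_isolated fE by blast
  then have "down_set S f \<subseteq> {f, \<zero>}" by (auto simp: down_set_def atoms_iff)
  then have "f \<in> ?I" using fE finite_subset by auto
  then show False using F f by blast
qed

section \<open>Prime filters of a semisimple semigroup\<close>

text \<open>For an atom \<open>b\<close> below a join \<open>x \<uplus> y\<close>, restricting to the domain \<open>d\<close> of \<open>b\<close> writes \<open>b\<close> as the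
  join of \<open>x \<odot> d\<close> and \<open>y \<odot> d\<close>. Each of these is \<open>b\<close> or \<open>\<zero>\<close>, and they cannot both be
  \<open>\<zero>\<close>.\<close>

lemma atom_up_prime_filter:
  assumes b: "b \<in> atoms S"
  shows "up_set S {b} \<in> prime_filters S"
proof -
  have [simp]: "b \<in> carrier S" using b by (simp add: atoms_iff)
  have "\<zero> \<notin> up_set S {b}"
    using b le_zero by (auto simp: mem_up_singleton atoms_iff)
  moreover have "x \<in> up_set S {b} \<or> y \<in> up_set S {b}"
    if xy: "x \<in> carrier S" "y \<in> carrier S" "compatible S x y" and j: "x \<uplus> y \<in> up_set S {b}" for x y
  proof -
    define d where "d = b\<^sup>\<star> \<odot> b"
    have d [simp]: "d \<in> E" by (simp add: d_def)
    have le: "b \<preceq> x \<uplus> y" using j by (simp add: mem_up_singleton)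
    have beq: "b = (x \<uplus> y) \<odot> d"
      using le_eq_mult_sdom [OF le] join_closed [OF xy] by (simp add: d_def)
    have "x \<odot> d \<preceq> (x \<uplus> y) \<odot> d" "y \<odot> d \<preceq> (x \<uplus> y) \<odot> d"
      using xy by (simp_all add: mult_right_mono join_upper1 join_upper2)
    then have "x \<odot> d \<preceq> b" "y \<odot> d \<preceq> b" unfolding beq [symmetric] .
    then have cases: "x \<odot> d = b \<or> x \<odot> d = \<zero>" "y \<odot> d = b \<or> y \<odot> d = \<zero>"
      using b xy by (simp_all add: atoms_iff)
    have "(x \<odot> d) \<uplus> (y \<odot> d) = b"
      using mult_join_right [OF xy(1,2) _ xy(3), of d] beq by simp
    moreover have "\<zero> \<uplus> \<zero> = \<zero>"
      using idem_join_least [of \<zero> \<zero> \<zero>] le_zero by simp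
    ultimately have "x \<odot> d = b \<or> y \<odot> d = b"
      using cases b by (auto simp: atoms_iff)
    then show ?thesis
      using mult_idem_le [of x d] mult_idem_le [of y d] xy by (auto simp: mem_up_singleton)
  qed
  ultimately show ?thesis
    using up_singleton_filter [of b] by (simp add: prime_filters_def)
qed

end

context boolean_inverse_semigroup
begin

text \<open>The complement comes from the lattice of idempotents below \<open>e\<close>, whose meets and joins are
  formed inside that interval. Only their universal properties are used, to identify them with
  the product and the natural join in \<open>S\<close>.\<close>

lemma relative_complement:
  assumes c: "c \<in> E" and e: "e \<in> E" and ce: "c \<preceq> e"
  obtains g where "g \<in> E" "c \<odot> g = \<zero>" "c \<uplus> g = e"
proof -
  interpret gen: generalized_boolean_lattice "idempotent_order S" by (rule idempotents_boolean)
  define L where "L = (idempotent_order S)\<lparr>carrier := {x \<in> carrier (idempotent_order S). x \<sqsubseteq>\<^bsub>idempotent_order S\<^esub> e}\<rparr>"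
  have carr: "carrier L = {x \<in> E. x \<preceq> e}" and le: "x \<sqsubseteq>\<^bsub>L\<^esub> y \<longleftrightarrow> x \<preceq> y" for x y
    by (simp_all add: L_def idempotent_order_def)
  interpret L: unital_boolean_lattice L
    unfolding L_def by (rule gen.principal_ideal_boolean) (simp add: idempotent_order_def e)
  obtain g where g: "g \<in> carrier L" "c \<sqinter>\<^bsub>L\<^esub> g = \<bottom>\<^bsub>L\<^esub>" "c \<squnion>\<^bsub>L\<^esub> g = \<top>\<^bsub>L\<^esub>"
    using L.complement_exists [of c] c ce carr by blast
  have gE: "g \<in> E" "g \<preceq> e" and cL: "c \<in> carrier L" using g carr c ce by auto
  have zL: "\<zero> \<in> carrier L" and eL: "e \<in> carrier L" using e by (simp_all add: carr)
  have cg: "c \<odot> g \<preceq> c" "c \<odot> g \<preceq> g" "c \<odot> g \<in> E" using idem_meet_le c gE by simp_all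
  then have "c \<odot> g \<in> carrier L" using le_trans [of "c \<odot> g" c e] ce c e by (simp add: carr)
  then have "c \<odot> g \<preceq> \<bottom>\<^bsub>L\<^esub>" using L.meet_le [of "c \<odot> g" c g] cg g cL le by simp
  moreover have "\<bottom>\<^bsub>L\<^esub> \<preceq> \<zero>" "\<bottom>\<^bsub>L\<^esub> \<in> E"
    using L.bottom_lower [OF zL] L.bottom_closed carr le by auto
  ultimately have "c \<odot> g \<preceq> \<zero>" using le_trans [of "c \<odot> g" "\<bottom>\<^bsub>L\<^esub>" \<zero>] cg(3) by simp
  then have 1: "c \<odot> g = \<zero>" using le_zero cg(3) by simp
  have j: "c \<uplus> g \<preceq> e" using idem_join_least ce gE c e by simp
  then have "c \<uplus> g \<in> carrier L" using carr c gE by simp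
  then have "\<top>\<^bsub>L\<^esub> \<preceq> c \<uplus> g"
    using L.join_le [of c "c \<uplus> g" g] idem_join_upper [OF c gE(1)] g cL le by simp
  moreover have "e \<preceq> \<top>\<^bsub>L\<^esub>" "\<top>\<^bsub>L\<^esub> \<in> E"
    using L.top_higher [OF eL] L.top_closed carr le by auto
  ultimately have "e \<preceq> c \<uplus> g" using le_trans [of e "\<top>\<^bsub>L\<^esub>" "c \<uplus> g"] e c gE by simp
  then have "c \<uplus> g = e" using j le_antisym e c gE by simp
  then show thesis using that 1 gE by blast
qed

text \<open>If \<open>c \<preceq> b\<close> and \<open>g\<close> is the complement of the domain of \<open>c\<close> in the domain of \<open>b\<close>, then \<open>b\<close>
  is the join of \<open>c\<close> and \<open>b \<odot> g\<close>. A prime filter with least element \<open>b\<close> contains one of the two,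
  which forces \<open>c = b\<close> in the first case and \<open>c = \<zero>\<close> in the second.\<close>

lemma prime_principal_atom:
  assumes b: "b \<in> carrier S" and F: "up_set S {b} \<in> prime_filters S"
  shows "b \<in> atoms S"
proof -
  note [simp] = b
  have mem: "x \<in> up_set S {b} \<longleftrightarrow> x \<in> carrier S \<and> b \<preceq> x" for x
    by (rule mem_up_singleton [OF b])
  have "c = b \<or> c = \<zero>" if c [simp]: "c \<in> carrier S" and cb: "c \<preceq> b" for c
  proof -
    define d where "d = b\<^sup>\<star> \<odot> b"
    define h where "h = c\<^sup>\<star> \<odot> c"
    have [simp]: "d \<in> E" "h \<in> E" by (simp_all add: d_def h_def)
    have "h \<preceq> d" using sdom_mono [OF cb] by (simp add: d_def h_def)
    then obtain g where [simp]: "g \<in> E" and hg: "h \<odot> g = \<zero>" "h \<uplus> g = d"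
      using relative_complement [of h d] by auto
    have bd: "b \<odot> d = b" by (simp add: d_def mult_sinv_mult mult_assoc [symmetric])
    have bh: "b \<odot> h = c" using le_eq_mult_sdom [OF cb] by (simp add: h_def)
    have join: "(b \<odot> h) \<uplus> (b \<odot> g) = b"
      using mult_join_left [of h g b] hg bd by simp
    have "(b \<odot> h)\<^sup>\<star> \<odot> (b \<odot> g) = h \<odot> (d \<odot> g)"
      by (simp add: sinv_mult d_def mult_assoc)
    moreover have "(b \<odot> h) \<odot> (b \<odot> g)\<^sup>\<star> = b \<odot> (h \<odot> g) \<odot> b\<^sup>\<star>"
      by (simp add: sinv_mult mult_assoc)
    ultimately have comp: "compatible S (b \<odot> h) (b \<odot> g)"
      unfolding compatible_def by (simp only:) simp
    have "(b \<odot> h) \<uplus> (b \<odot> g) \<in> up_set S {b}" unfolding join by (simp add: mem)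
    then have "b \<odot> h \<in> up_set S {b} \<or> b \<odot> g \<in> up_set S {b}"
      using F comp unfolding prime_filters_def by simp
    then show ?thesis
    proof
      assume "b \<odot> h \<in> up_set S {b}"
      then show ?thesis using bh cb le_antisym mem by auto
    next
      assume "b \<odot> g \<in> up_set S {b}"
      then have "b \<odot> g = b" using mem mult_idem_le [of b g] le_antisym by simp
      then have "c = b \<odot> g \<odot> h" using bh by simp
      also have "\<dots> = \<zero>"
        using hg(1) idem_commute [of g h] by (simp add: mult_assoc)
      finally show ?thesis by simp
    qed
  qed
  moreover have "b \<noteq> \<zero>" using F mem [of \<zero>] by (auto simp: prime_filters_def)
  ultimately show ?thesis by (simp add: atoms_iff)
qed

lemma prime_filters_eq_image:
  assumes "semisimple S"
  shows "prime_filters S = (\<lambda>b. up_set S {b}) ` atoms S"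
proof (intro subset_antisym subsetI)
  fix F assume F: "F \<in> prime_filters S"
  then have filt: "is_filter S F" by (simp add: prime_filters_def)
  then obtain a where "a \<in> F" "a \<in> carrier S" unfolding is_filter_def by blast
  then obtain b where "b \<in> F" "F = up_set S {b}"
    using filter_principal [OF filt] assms by (auto simp: semisimple_def)
  moreover from this have "b \<in> atoms S"
    using prime_principal_atom F filt unfolding is_filter_def by blast
  ultimately show "F \<in> (\<lambda>b. up_set S {b}) ` atoms S" by blast
qed (auto simp: atom_up_prime_filter)

lemma discrete_if_semisimple:
  assumes ss: "semisimple S" and F: "F \<in> prime_filters S"
  shows "\<exists>a\<in>carrier S. basic_open S a = {F}"
proof -
  obtain b where b: "b \<in> atoms S" "F = up_set S {b}"
    using prime_filters_eq_image [OF ss] F by blast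
  have "G = F" if G: "G \<in> prime_filters S" "b \<in> G" for G
  proof -
    obtain c where c: "c \<in> atoms S" "G = up_set S {c}"
      using prime_filters_eq_image [OF ss] G by blast
    then have "c \<preceq> b" using G by (simp add: atom_closed mem_up_singleton)
    then have "c = b" using b c by (auto simp: atoms_iff)
    then show ?thesis using b c by simp
  qed
  moreover have "b \<in> F" using b by (simp add: atom_closed mem_up_singleton)
  ultimately have "basic_open S b = {F}" using F unfolding basic_open_def by blast
  then show ?thesis using b atom_closed by blast
qed

lemma prime_filters_isomorphic_atoms:
  assumes "semisimple S"
  shows "isomorphic_groupoids (prime_filter_groupoid S) (atom_groupoid S)"
proof (rule isomorphic_groupoidsI [where h = "\<lambda>b. up_set S {b}"])
  show "groupoid (atom_groupoid S)" by (rule groupoid_atoms)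
  have "inj_on (\<lambda>b. up_set S {b}) (atoms S)"
    by (rule inj_onI) (simp add: up_singleton_eq_iff atom_closed)
  then show "bij_betw (\<lambda>b. up_set S {b}) (carrier (atom_groupoid S)) (carrier (prime_filter_groupoid S))"
    by (simp add: bij_betw_def prime_filters_eq_image [OF assms] atom_groupoid_def
        prime_filter_groupoid_def)
qed (simp_all add: atom_groupoid_def prime_filter_groupoid_def atom_closed sinv_image_up up_set_mult
    sdom_def sran_def)

end

theorem theorem5p7:
  fixes S :: "'a zero_semigroup"
  assumes "boolean_inverse_semigroup S"
  shows "(semisimple S \<longrightarrow> isomorphic_groupoids (prime_filter_groupoid S) (atom_groupoid S)) \<and>
         (semisimple S \<longleftrightarrow> prime_filter_topology S = discrete_topology (prime_filters S))"
proof -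
  interpret boolean_inverse_semigroup S by (rule assms)
  show ?thesis
    unfolding discrete_iff
    using prime_filters_isomorphic_atoms discrete_if_semisimple semisimple_if_discrete by blast
qed

end
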